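(* Let $\mathcal{B}$ be the family of all rank-labeled binary trees on $[T]$, and for $B\in\mathcal{B}$ and $t\in[T]$ let $l^B(t)$ and $r^B(t)$ be the numbers of nodes in the left and right subtree of $t$ in $B$. If $\mathrm{CU}$ is strictly concave, then the description of $\operatorname{epi}(\mathrm{LCU}^\Sigma)$ as the set of all $(v,c)\in\mathbb{R}^{T}\times\mathbb{R}$ satisfying the inequalities $$c\ge\sum_{t\in[T]}\delta^t\big(l^B(t),r^B(t)\big)\,v^t\quad (B\in\mathcal{B}),\qquad v^t\ge 0,\quad v^t\le 1\quad (t\in[T])$$ is irredundant, i.e. no single one of these inequalities (indexed by the trees $B\in\mathcal{B}$ and by the periods $t\in[T]$) can be omitted without changing the described set.
   Context: Fix an integer $T\ge 1$, $[T]=\{1,\dots,T\}$ (periods), period lengths $L^1,\dots,L^T>0$, a pre-model offline time $\mathrm{PDT}\ge 0$, and a start-up cost function $\mathrm{CU}:[0,\infty)\to[0,\infty)$ that is (weakly) increasing, concave, and satisfies $\mathrm{CU}(0)=0$. For $t\in[T]$ and $l\in\{0,\dots,t-1\}$ let $\mathrm{OL}^t(l)=\sum_{j=1}^{l}L^{t-j}$ if $l<t-1$, and $\mathrm{OL}^t(l)=\sum_{j=1}^{l}L^{t-j}+\mathrm{PDT}$ if $l=t-1$; let $\mathrm{CU}^t(l)=\mathrm{CU}(\mathrm{OL}^t(l))$. For $v=(v^1,\dots,v^T)\in\{0,1\}^T$ let $\mathrm{ol}^t(v)=\max\{l\in\{0,\dots,t-1\}: v^{t-1}=\dots=v^{t-l}=0\}$,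 $\mathrm{DCU}^t(v)=\mathrm{CU}^t(\mathrm{ol}^t(v))$ if $v^t=1$ and $\mathrm{DCU}^t(v)=0$ otherwise, and $\mathrm{DCU}^\Sigma(v)=\sum_{t=1}^T\mathrm{DCU}^t(v)$. Let $\operatorname{epi}(\mathrm{DCU}^\Sigma)=\{(v,c): v\in\{0,1\}^T,\ c\ge \mathrm{DCU}^\Sigma(v)\}$, and let $\mathrm{LCU}^\Sigma:[0,1]^T\to\mathbb{R}$ be the unique function whose epigraph $\operatorname{epi}(\mathrm{LCU}^\Sigma)=\{(v,c):v\in[0,1]^T,\ c\ge\mathrm{LCU}^\Sigma(v)\}$ equals $\operatorname{conv}(\operatorname{epi}(\mathrm{DCU}^\Sigma))$. For $t\in[T]$ define $\delta^t:\{0,\dots,t-1\}\times\{0,\dots,T-t\}\to\mathbb{R}$ by $\delta^t(l,r)=\mathrm{CU}^t(l)+\mathrm{CU}^{t+r+1}(r)-\mathrm{CU}^{t+r+1}(l+r+1)$ if $t+r<T$, and $\delta^t(l,r)=\mathrm{CU}^t(l)$ if $t+r=T$. A binary tree is a rooted tree in which every node has at most one left child and at most one right child. It is a rank-labeled binary tree on $[T]$ if its node set is $[T]$ and the in-order (left-to-right) position of each node $t$ is $t$; i.e. all nodes in the left subtree of $t$ are smaller than $t$ and all nodes in the right subtree of $t$ are larger than $t$. *)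

theory Defs
  imports "HOL-Analysis.Analysis" "HOL-Library.Tree" "HOL-Library.FuncSet"
begin

definition strictly_concave_on :: "'a::real_vector set \<Rightarrow> ('a \<Rightarrow> real) \<Rightarrow> bool" where
  "strictly_concave_on S f \<longleftrightarrow> convex S \<and>
     (\<forall>x\<in>S. \<forall>y\<in>S. \<forall>u. x \<noteq> y \<and> 0 < u \<and> u < 1 \<longrightarrow>
        (1 - u) * f x + u * f y < f ((1 - u) *\<^sub>R x + u *\<^sub>R y))"

text \<open>
  Operational vectors live in \<^typ>\<open>real ^ 'n\<close> for a finite linearly ordered index type, and
  the number of periods is \<open>T = CARD('n)\<close>. The \<open>t\<close>-th smallest index (counted from 1) plays
  the role of period \<open>t\<close>; so \<open>at_period v t\<close> is the entry of \<open>v\<close> for period \<open>t\<close> and is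
  meaningful for \<open>t \<in> {1..T}\<close> only.
\<close>

definition period :: "nat \<Rightarrow> 'n::{finite,linorder}" where
  "period t = (THE i. card {..i} = t)"

definition at_period :: "real ^ 'n::{finite,linorder} \<Rightarrow> nat \<Rightarrow> real" where
  "at_period v t = v $ period t"

definition binary_vectors :: "(real ^ 'n) set" where
  "binary_vectors = {v. \<forall>i. v $ i \<in> {0, 1}}"

definition unit_cube :: "(real ^ 'n) set" where
  "unit_cube = {v. \<forall>i. v $ i \<in> {0..1}}"

text \<open>
  Throughout, \<open>L t\<close> is the length of period \<open>t\<close>, \<open>PDT\<close> the pre-model offline time and
  \<open>CU\<close> the start-up cost function, of which only the values on \<open>{0..}\<close> matter.
\<close>

definition OL :: "(nat \<Rightarrow> real) \<Rightarrow> real \<Rightarrow> nat \<Rightarrow> nat \<Rightarrow> real" where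
  "OL L PDT t l =
     (if l < t - 1 then \<Sum>j=1..l. L (t - j) else (\<Sum>j=1..l. L (t - j)) + PDT)"

definition CUt :: "(nat \<Rightarrow> real) \<Rightarrow> real \<Rightarrow> (real \<Rightarrow> real) \<Rightarrow> nat \<Rightarrow> nat \<Rightarrow> real" where
  "CUt L PDT CU t l = CU (OL L PDT t l)"

definition ol :: "nat \<Rightarrow> real ^ 'n::{finite,linorder} \<Rightarrow> nat" where
  "ol t v = Max {l \<in> {0..t - 1}. \<forall>j\<in>{1..l}. at_period v (t - j) = 0}"

definition DCU ::
  "(nat \<Rightarrow> real) \<Rightarrow> real \<Rightarrow> (real \<Rightarrow> real) \<Rightarrow> nat \<Rightarrow> real ^ 'n::{finite,linorder} \<Rightarrow> real" where
  "DCU L PDT CU t v = (if at_period v t = 1 then CUt L PDT CU t (ol t v) else 0)"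

definition DCU_sum ::
  "(nat \<Rightarrow> real) \<Rightarrow> real \<Rightarrow> (real \<Rightarrow> real) \<Rightarrow> real ^ 'n::{finite,linorder} \<Rightarrow> real" where
  "DCU_sum L PDT CU v = (\<Sum>t=1..CARD('n). DCU L PDT CU t v)"

text \<open>Extensionality only fixes a value outside the domain \<^const>\<open>unit_cube\<close>.\<close>

definition LCU_sum ::
  "(nat \<Rightarrow> real) \<Rightarrow> real \<Rightarrow> (real \<Rightarrow> real) \<Rightarrow> real ^ 'n::{finite,linorder} \<Rightarrow> real" where
  "LCU_sum L PDT CU =
     (THE f. f \<in> extensional unit_cube \<and>
        epigraph unit_cube f = convex hull (epigraph binary_vectors (DCU_sum L PDT CU)))"

definition delta ::
  "nat \<Rightarrow> (nat \<Rightarrow> real) \<Rightarrow> real \<Rightarrow> (real \<Rightarrow> real) \<Rightarrow> nat \<Rightarrow> nat \<Rightarrow> nat \<Rightarrow> real" where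
  "delta T L PDT CU t l r =
     (if t + r < T
      then CUt L PDT CU t l + CUt L PDT CU (t + r + 1) r - CUt L PDT CU (t + r + 1) (l + r + 1)
      else CUt L PDT CU t l)"

definition rank_labeled_trees :: "nat \<Rightarrow> nat tree set" where
  "rank_labeled_trees T = {B. inorder B = [1..<T + 1]}"

text \<open>
  A node of \<^typ>\<open>'a tree\<close> is identified with its label, which is unambiguous as the labels of a
  rank-labeled tree are distinct.
\<close>

definition subtree_at :: "'a tree \<Rightarrow> 'a \<Rightarrow> 'a tree" where
  "subtree_at B t = (THE S. S \<in> subtrees B \<and> S \<noteq> Leaf \<and> value S = t)"

definition left_nodes :: "'a tree \<Rightarrow> 'a \<Rightarrow> nat" where
  "left_nodes B t = size (left (subtree_at B t))"

definition right_nodes :: "'a tree \<Rightarrow> 'a \<Rightarrow> nat" where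
  "right_nodes B t = size (right (subtree_at B t))"

text \<open>
  The solution set of the tree inequalities for \<open>B \<in> \<B>\<close>, the lower bounds for \<open>t \<in> P\<close> and the
  upper bounds for \<open>t \<in> Q\<close>; the full system has all trees and \<open>P = Q = {1..T}\<close>.
\<close>

definition solutions ::
  "(nat \<Rightarrow> real) \<Rightarrow> real \<Rightarrow> (real \<Rightarrow> real) \<Rightarrow> nat tree set \<Rightarrow> nat set \<Rightarrow> nat set \<Rightarrow>
     ((real ^ 'n::{finite,linorder}) \<times> real) set" where
  "solutions L PDT CU \<B> P Q =
     {(v, c).
        (\<forall>B\<in>\<B>. c \<ge> (\<Sum>t=1..CARD('n).
             delta (CARD('n)) L PDT CU t (left_nodes B t) (right_nodes B t) * at_period v t)) \<and>
        (\<forall>t\<in>P. at_period v t \<ge> 0) \<and>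
        (\<forall>t\<in>Q. at_period v t \<le> 1)}"

end

theory Submission
  imports Defs
begin

text \<open>
  Add two artificial periods \<open>0\<close> and \<open>T + 1\<close> and let \<open>c i j\<close> be the start-up cost of the gap
  between consecutive online periods \<open>i < j\<close>. Then \<open>\<delta>\<^sup>t\<close> is the cost \<open>c i t + c t k - c i k\<close> of
  switching on \<open>t\<close> inside a gap, and concavity makes this cost grow with the gap. Hence a tree,
  read from the root down as an order of switching on the periods, underestimates the cost of a
  binary vector \<open>v\<close>, with equality iff \<open>v\<close> is heap ordered on the tree. Every vector of the cube is
  heap ordered on some tree and is a convex combination of binary vectors with the same property;
  this yields the hull. A tree is determined by the binary vectors that are heap ordered on it, so
  at the average of these vectors its inequality is the only one that is tight.
\<close>

section \<open>Path costs, tree values and heap-ordered trees\<close>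

text \<open>With gap costs as \<open>c\<close>, the path from \<open>0\<close> through the online
  periods to \<open>T + 1\<close> has the total start-up cost as its length.\<close>

primrec path_cost :: "(nat \<Rightarrow> nat \<Rightarrow> real) \<Rightarrow> nat \<Rightarrow> nat list \<Rightarrow> nat \<Rightarrow> real" where
  "path_cost c lo [] hi = c lo hi"
| "path_cost c lo (x # xs) hi = c lo x + path_cost c x xs hi"

lemma path_cost_append:
  "path_cost c lo (xs @ x # ys) hi = path_cost c lo xs x + path_cost c x ys hi"
  by (induction xs arbitrary: lo) auto

text \<open>Instead of subtree sizes, the recursion passes down \<open>lo\<close> and
  \<open>hi\<close>, the nearest ancestors on either side of the subtree (or the artificial end
  periods). The coefficient at \<open>x\<close> is the price of a detour through \<open>x\<close> on
  the way from \<open>lo\<close> to \<open>hi\<close>.\<close>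

primrec tree_val ::
  "(nat \<Rightarrow> nat \<Rightarrow> real) \<Rightarrow> (nat \<Rightarrow> real) \<Rightarrow> nat \<Rightarrow> nat \<Rightarrow> nat tree \<Rightarrow> real" where
  "tree_val c v lo hi Leaf = 0"
| "tree_val c v lo hi (Node l x r) =
     (c lo x + c x hi - c lo hi) * v x + tree_val c v lo x l + tree_val c v x hi r"

lemma tree_val_add:
  "tree_val c (\<lambda>t. u t + w t) lo hi B = tree_val c u lo hi B + tree_val c w lo hi B"
  by (induction B arbitrary: lo hi) (auto simp: algebra_simps)

lemma tree_val_scale: "tree_val c (\<lambda>t. a * u t) lo hi B = a * tree_val c u lo hi B"
  by (induction B arbitrary: lo hi) (auto simp: algebra_simps)

lemma tree_val_sum:
  "tree_val c (\<lambda>t. \<Sum>s\<in>A. u s t) lo hi B = (\<Sum>s\<in>A. tree_val c (u s) lo hi B)"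
proof -
  have "tree_val c (\<lambda>t. 0) lo hi B = 0"
    using tree_val_scale[of c 0 "\<lambda>t. 0" lo hi B] by simp
  then show ?thesis
    by (induction A rule: infinite_finite_induct) (simp_all add: tree_val_add)
qed

primrec heap_ordered :: "('a \<Rightarrow> real) \<Rightarrow> 'a tree \<Rightarrow> bool" where
  "heap_ordered v Leaf \<longleftrightarrow> True"
| "heap_ordered v (Node l x r) \<longleftrightarrow>
     (\<forall>y\<in>set_tree l \<union> set_tree r. v y \<le> v x) \<and> heap_ordered v l \<and> heap_ordered v r"

text \<open>Only the weak order of the values matters. This is what lets the parts of a fractional
  vector inherit its tree.\<close>

lemma heap_ordered_mono:
  assumes "heap_ordered v B"
    and "\<And>x y. x \<in> set_tree B \<Longrightarrow> y \<in> set_tree B \<Longrightarrow> v y \<le> v x \<Longrightarrow> w y \<le> w x"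
  shows "heap_ordered w B"
  using assms by (induction B) auto

lemma heap_ordered_cong:
  assumes "\<And>t. t \<in> set_tree B \<Longrightarrow> u t = w t"
  shows "heap_ordered u B \<longleftrightarrow> heap_ordered w B"
  using heap_ordered_mono[of u B w] heap_ordered_mono[of w B u] assms by auto

text \<open>The Cartesian tree: take a position of maximal value as the root and recurse on the
  lists to its left and right.\<close>

lemma heap_ordered_exists: "\<exists>B. inorder B = xs \<and> heap_ordered v B"
proof (induction xs rule: length_induct)
  case (1 xs)
  show ?case
  proof (cases "xs = []")
    case True
    then show ?thesis by (intro exI[of _ Leaf]) simp
  next
    case False
    then have ne: "finite (v ` set xs)" "v ` set xs \<noteq> {}" by auto
    obtain x where x: "x \<in> set xs" "v x = Max (v ` set xs)"
      using Max_in[OF ne] by auto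
    have mx: "v y \<le> v x" if "y \<in> set xs" for y
      using Max_ge[OF ne(1)] that x(2) by simp
    obtain ys zs where xs: "xs = ys @ x # zs" using x(1) by (meson split_list)
    have "length ys < length xs" "length zs < length xs" using xs by auto
    then obtain l r where "inorder l = ys" "heap_ordered v l" "inorder r = zs" "heap_ordered v r"
      using 1 by meson
    then show ?thesis using mx xs
      by (intro exI[of _ "Node l x r"]) (auto simp flip: set_inorder)
  qed
qed

text \<open>The singleton of the root is heap ordered on \<open>B\<close>, and on \<open>B'\<close>
  this forces the same root. As labels are distinct, the root splits the common inorder list in only
  one way, and induction applies to both sides.\<close>

lemma heap_ordered_unique:
  assumes "inorder B' = inorder B" "distinct (inorder B)"
    and "\<And>S. S \<subseteq> set_tree B \<Longrightarrow> heap_ordered (indicator S) B \<Longrightarrow> heap_ordered (indicator S) B'"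
  shows "B' = B"
  using assms
proof (induction B arbitrary: B')
  case Leaf
  then show ?case by simp
next
  case (Node l x r)
  have zero: "heap_ordered (indicator S) t" if "S \<inter> set_tree t = {}" for S and t :: "'a tree"
    using that by (induction t) (auto simp: indicator_def)
  obtain l' x' r' where B': "B' = Node l' x' r'"
    using Node.prems(1) by (cases B') auto
  have eqset: "set_tree B' = set_tree (Node l x r)"
    using Node.prems(1) by (metis set_inorder)
  have d: "x \<notin> set_tree l" "x \<notin> set_tree r" "set_tree l \<inter> set_tree r = {}"
    using Node.prems(2) by auto
  have "heap_ordered (indicator {x}) (Node l x r)"
    using d by (auto simp: indicator_def intro!: zero)
  then have hx: "heap_ordered (indicator {x}) B'" using Node.prems(3) by simp
  have "x' = x"
  proof (rule ccontr)
    assume "x' \<noteq> x"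
    moreover from this have "x \<in> set_tree l' \<union> set_tree r'" using eqset B' by auto
    ultimately have "(indicator {x} x :: real) \<le> indicator {x} x'"
      using hx unfolding B' by (metis heap_ordered.simps(2))
    then show False using \<open>x' \<noteq> x\<close> by simp
  qed
  have split: "inorder l' @ x # inorder r' = inorder l @ x # inorder r"
    using Node.prems(1) B' \<open>x' = x\<close> by simp
  have dl: "x \<notin> set (inorder l)" "x \<notin> set (inorder r)" using d by simp_all
  have "inorder l' = inorder l \<and> inorder r' = inorder r"
    using split dl by (metis append_Cons_eq_iff)
  then have io: "inorder l' = inorder l" "inorder r' = inorder r" by auto
  then have st: "set_tree l' = set_tree l" "set_tree r' = set_tree r" by (metis set_inorder)+
  \<comment> \<open>Adding the root turns an ordered set of the subtrees into an ordered set of the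
    whole tree, to which the hypothesis applies. The subtrees do not contain \<open>x\<close> and so
    do not notice the addition.\<close>
  have key: "heap_ordered (indicator S) l' \<and> heap_ordered (indicator S) r'"
    if "S \<subseteq> set_tree l \<union> set_tree r" "heap_ordered (indicator S) l" "heap_ordered (indicator S) r"
    for S
  proof -
    have c: "heap_ordered (indicator (insert x S)) t \<longleftrightarrow> heap_ordered (indicator S) t"
      if "x \<notin> set_tree t" for t
      using that by (intro heap_ordered_cong) (auto simp: indicator_def)
    have "heap_ordered (indicator (insert x S)) (Node l x r)"
      using that d c by (auto simp: indicator_def)
    then have "heap_ordered (indicator (insert x S)) B'"
      using Node.prems(3)[of "insert x S"] that(1) by auto
    then show ?thesis using c d st unfolding B' by simp
  qed
  have "l' = l"
  proof (rule Node.IH(1)[OF io(1)])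
    fix S assume S: "S \<subseteq> set_tree l" "heap_ordered (indicator S) l"
    have "heap_ordered (indicator S) r" using S d by (intro zero) auto
    then show "heap_ordered (indicator S) l'" using key S by auto
  qed (use Node.prems(2) in simp)
  moreover have "r' = r"
  proof (rule Node.IH(2)[OF io(2)])
    fix S assume S: "S \<subseteq> set_tree r" "heap_ordered (indicator S) r"
    have "heap_ordered (indicator S) l" using S d by (intro zero) auto
    then show "heap_ordered (indicator S) r'" using key S by auto
  qed (use Node.prems(2) in simp)
  ultimately show ?case using B' \<open>x' = x\<close> by simp
qed

text \<open>The position of the root splits \<open>xs\<close> into two shorter lists, each with
  finitely many trees by induction.\<close>

lemma finite_trees_inorder: "finite {B. inorder B = xs}"
proof (induction xs rule: length_induct)
  case (1 xs)
  define A where "A = (\<Union>i<length xs. (\<lambda>(l, r). Node l (xs ! i) r) `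
    ({B. inorder B = take i xs} \<times> {B. inorder B = drop (Suc i) xs}))"
  have "finite A" unfolding A_def using 1 by (intro finite_UN_I finite_imageI finite_cartesian_product) auto
  moreover have "{B. inorder B = xs} \<subseteq> insert Leaf A"
  proof
    fix B assume "B \<in> {B. inorder B = xs}"
    then show "B \<in> insert Leaf A"
    proof (cases B)
      case (Node l x r)
      then have "xs = inorder l @ x # inorder r" using \<open>B \<in> _\<close> by simp
      then show ?thesis unfolding A_def Node
        by (intro insertI2 UN_I[of "length (inorder l)"] image_eqI[of _ _ "(l, r)"])
           (auto simp: nth_append simp del: length_inorder)
    qed simp
  qed
  ultimately show ?case by (meson finite_insert finite_subset)
qed

section \<open>Trees under strictly Monge costs\<close>

text \<open>
  The strict Monge property says that the detour cost of visiting \<open>x\<close> between its neighbours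
  strictly grows when the neighbours move away; this is strict submodularity of the
  start-up costs.
\<close>

locale strict_monge =
  fixes c :: "nat \<Rightarrow> nat \<Rightarrow> real" and N :: nat
  assumes monge: "\<lbrakk>i' \<le> i; i < x; x < k; k \<le> k'; k' \<le> N; i' \<noteq> i \<or> k' \<noteq> k\<rbrakk> \<Longrightarrow>
    c i x + c x k - c i k < c i' x + c x k' - c i' k'"
begin

text \<open>All legs cancel except those between \<open>x\<close> and its neighbours on the path,
  which are the last entry of \<open>xs\<close> or \<open>lo\<close> and the first entry of
  \<open>ys\<close> or \<open>hi\<close>. As \<open>xs\<close> or \<open>ys\<close> is nonempty, at
  least one neighbour lies strictly inside the interval, so the Monge inequality is strict.\<close>

lemma insertion_cost:
  assumes "sorted_wrt (<) (lo # xs @ x # ys @ [hi])" "hi \<le> N" "xs \<noteq> [] \<or> ys \<noteq> []"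
  shows "path_cost c lo xs x + path_cost c x ys hi - path_cost c lo (xs @ ys) hi
    < c lo x + c x hi - c lo hi"
proof (cases xs rule: rev_cases)
  case Nil
  then obtain y ys' where ys: "ys = y # ys'" using assms by (cases ys) auto
  then show ?thesis using Nil assms monge[of lo lo x y hi] by auto
next
  case xs: (snoc xs' j)
  show ?thesis
  proof (cases ys)
    case Nil
    then show ?thesis using xs assms monge[of lo j x hi hi]
      by (auto simp: path_cost_append sorted_wrt_append)
  next
    case (Cons y ys')
    then show ?thesis using xs assms monge[of lo j x y hi]
      by (auto simp: path_cost_append sorted_wrt_append)
  qed
qed

text \<open>If the root is online, the path splits there and the two sides add up. If the root and
  everything below it are offline, both sides vanish. If the root is offline above an online node,
  heap order fails, and so must equality.\<close>

lemma tree_val_binary: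
  assumes "sorted_wrt (<) (lo # inorder B @ [hi])" "hi \<le> N" "\<And>t. v t \<in> {0, 1}"
  shows "tree_val c v lo hi B \<le> path_cost c lo (filter (\<lambda>t. v t = 1) (inorder B)) hi - c lo hi \<and>
    (tree_val c v lo hi B = path_cost c lo (filter (\<lambda>t. v t = 1) (inorder B)) hi - c lo hi
       \<longleftrightarrow> heap_ordered v B)"
  using assms(1,2)
proof (induction B arbitrary: lo hi)
  case Leaf
  then show ?case by simp
next
  case (Node l x r)
  define F where "F B = filter (\<lambda>t. v t = 1) (inorder B)" for B
  have le1: "v t \<le> 1" for t using assms(3)[of t] by auto
  have L: "tree_val c v lo x l \<le> path_cost c lo (F l) x - c lo x \<and>
    (tree_val c v lo x l = path_cost c lo (F l) x - c lo x \<longleftrightarrow> heap_ordered v l)"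
    unfolding F_def using Node.prems by (intro Node.IH(1)) (auto simp: sorted_wrt_append)
  have R: "tree_val c v x hi r \<le> path_cost c x (F r) hi - c x hi \<and>
    (tree_val c v x hi r = path_cost c x (F r) hi - c x hi \<longleftrightarrow> heap_ordered v r)"
    unfolding F_def using Node.prems by (intro Node.IH(2)) (auto simp: sorted_wrt_append)
  show ?case
  proof (cases "v x = 1")
    case True
    then have "F (Node l x r) = F l @ x # F r" by (simp add: F_def)
    then have "path_cost c lo (F (Node l x r)) hi = path_cost c lo (F l) x + path_cost c x (F r) hi"
      by (simp add: path_cost_append)
    moreover have "heap_ordered v (Node l x r) \<longleftrightarrow> heap_ordered v l \<and> heap_ordered v r"
      using True le1 by simp
    moreover have "tree_val c v lo hi (Node l x r) =
        c lo x + c x hi - c lo hi + tree_val c v lo x l + tree_val c v x hi r"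
      using True by simp
    ultimately show ?thesis using L R unfolding F_def[symmetric] by argo
  next
    case False
    then have v0: "v x = 0" using assms(3)[of x] by auto
    have F: "F (Node l x r) = F l @ F r" using False by (simp add: F_def)
    have heap: "heap_ordered v (Node l x r) \<longleftrightarrow>
        F l = [] \<and> F r = [] \<and> heap_ordered v l \<and> heap_ordered v r"
    proof -
      have "v y \<le> 0 \<longleftrightarrow> v y \<noteq> 1" for y using assms(3)[of y] by auto
      then show ?thesis using v0 by (auto simp: F_def filter_empty_conv)
    qed
    have tv: "tree_val c v lo hi (Node l x r) = tree_val c v lo x l + tree_val c v x hi r"
      using v0 by simp
    show ?thesis
    proof (cases "F l = [] \<and> F r = []")
      case True
      then show ?thesis using L R F heap tv unfolding F_def[symmetric] by auto
    next
      case ne: False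
      \<comment> \<open>The induction hypotheses measure a path forced through the offline root
        \<open>x\<close>. The detour this adds costs less than the amount
        \<open>c lo x + c x hi - c lo hi\<close> by which their constants differ from the one
        claimed.\<close>
      have "path_cost c lo (F l) x + path_cost c x (F r) hi - path_cost c lo (F l @ F r) hi
          < c lo x + c x hi - c lo hi"
        using ne Node.prems
        by (intro insertion_cost)
           (auto simp: F_def sorted_wrt_append sorted_wrt_filter)
      then have "tree_val c v lo hi (Node l x r) < path_cost c lo (F (Node l x r)) hi - c lo hi"
        using L R unfolding F tv by linarith
      then show ?thesis using heap ne unfolding F_def[symmetric] by auto
    qed
  qed
qed

end

section \<open>Gap costs are strictly Monge\<close>

text \<open>Both \<open>x + h\<close> and \<open>y\<close> are convex combinations of
  \<open>x\<close> and \<open>y + h\<close>, with weights \<open>u\<close> and \<open>1 - u\<close>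
  interchanged. Adding the two strict inequalities gives the claim.\<close>

lemma strictly_concave_increments:
  assumes "strictly_concave_on {0..} f" "0 \<le> x" "x < y" "0 < (h::real)"
  shows "f (y + h) - f y < f (x + h) - f x"
proof -
  define u where "u = h / (y + h - x)"
  have u: "0 < u" "u < 1" using assms by (auto simp: u_def field_simps)
  have ud: "u * (y + h - x) = h" using assms by (simp add: u_def)
  have e1: "(1 - u) *\<^sub>R x + u *\<^sub>R (y + h) = x + h" using ud by (simp add: algebra_simps)
  have e2: "(1 - (1 - u)) *\<^sub>R x + (1 - u) *\<^sub>R (y + h) = y" using ud by (simp add: algebra_simps)
  have s: "(1 - u) * f x + u * f (y + h) < f ((1 - u) *\<^sub>R x + u *\<^sub>R (y + h))"
    if "0 < u" "u < 1" for u
    using assms that unfolding strictly_concave_on_def by auto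
  have "(1 - u) * f x + u * f (y + h) < f (x + h)" using s[of u] u e1 by simp
  moreover have "(1 - (1 - u)) * f x + (1 - u) * f (y + h) < f y"
    using s[of "1 - u"] u e2 by simp
  ultimately show ?thesis by (simp add: algebra_simps)
qed

text \<open>The next increment of the same width is nonnegative and strictly smaller, so the
  increment from \<open>x\<close> to \<open>y\<close> is positive.\<close>

lemma strictly_concave_mono_strict:
  assumes "strictly_concave_on {0..} f" "mono_on {0..} f" "0 \<le> x" "x < (y::real)"
  shows "f x < f y"
proof -
  have "f x \<le> f y" "f y \<le> f (y + (y - x))"
    using assms by (auto intro!: mono_onD[OF assms(2)])
  then show ?thesis
    using strictly_concave_increments[OF assms(1), of x y "y - x"] assms by simp
qed

text \<open>
  The cost of starting up in period \<open>j\<close> when the previous online period is \<open>i\<close>; the value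
  \<open>i = 0\<close> stands for the time before the model and \<open>j = T + 1\<close> for the time after it.
\<close>

definition gap_cost ::
  "nat \<Rightarrow> (nat \<Rightarrow> real) \<Rightarrow> real \<Rightarrow> (real \<Rightarrow> real) \<Rightarrow> nat \<Rightarrow> nat \<Rightarrow> real" where
  "gap_cost T L PDT CU i j = (if j \<le> T then CUt L PDT CU j (j - 1 - i) else 0)"

definition gap_length :: "(nat \<Rightarrow> real) \<Rightarrow> real \<Rightarrow> nat \<Rightarrow> nat \<Rightarrow> real" where
  "gap_length L PDT i j = (\<Sum>s\<in>{i<..<j}. L s) + (if i = 0 then PDT else 0)"

text \<open>The offline count \<open>j - 1 - i\<close> reaches its maximum \<open>j - 1\<close>,
  where \<open>PDT\<close> enters, exactly for \<open>i = 0\<close>.\<close>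

lemma OL_gap_length:
  assumes "i < j"
  shows "OL L PDT j (j - 1 - i) = gap_length L PDT i j"
proof -
  have "(\<Sum>s=1..j - 1 - i. L (j - s)) = (\<Sum>s\<in>{i<..<j}. L s)"
    by (rule sum.reindex_bij_witness[of _ "\<lambda>s. j - s" "\<lambda>s. j - s"]) auto
  then show ?thesis using assms by (auto simp: OL_def gap_length_def)
qed

lemma gap_cost_eq:
  assumes "i < j"
  shows "gap_cost T L PDT CU i j = (if j \<le> T then CU (gap_length L PDT i j) else 0)"
  using OL_gap_length[OF assms] by (simp add: gap_cost_def CUt_def)

text \<open>\<open>PDT\<close> is not counted twice: \<open>x\<close> is positive, so only the gap
  starting at \<open>i\<close> can carry it.\<close>

lemma gap_length_split:
  assumes "i < x" "x < k"
  shows "gap_length L PDT i k = gap_length L PDT i x + L x + gap_length L PDT x k"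
proof -
  have "{i<..<k} = {i<..<x} \<union> insert x {x<..<k}" using assms by auto
  moreover have "sum L ({i<..<x} \<union> insert x {x<..<k}) =
      sum L {i<..<x} + sum L (insert x {x<..<k})"
    by (intro sum.union_disjoint) auto
  ultimately show ?thesis using assms by (simp add: gap_length_def)
qed

lemma gap_length_nonneg:
  assumes "\<And>t. t \<in> {1..T} \<Longrightarrow> 0 < L t" "0 \<le> PDT" "k \<le> Suc T"
  shows "0 \<le> gap_length L PDT i k"
proof -
  have "0 \<le> sum L {i<..<k}"
  proof (rule sum_nonneg)
    fix s assume "s \<in> {i<..<k}"
    then have "s \<in> {1..T}" using assms(3) by auto
    then show "0 \<le> L s" by (rule less_imp_le[OF assms(1)])
  qed
  then show ?thesis using assms(2) by (simp add: gap_length_def)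
qed

text \<open>A node \<open>t\<close> with \<open>l\<close> nodes to its left and \<open>r\<close> to
  its right closes a gap from \<open>t - 1 - l\<close> to \<open>t + r + 1\<close>. The case
  \<open>t + r = T\<close> is the gap ending in \<open>T + 1\<close>, where two of the three costs
  are zero.\<close>

lemma delta_eq_gap_cost:
  assumes "l < t" "t + r \<le> T"
  shows "delta T L PDT CU t l r =
    gap_cost T L PDT CU (t - 1 - l) t + gap_cost T L PDT CU t (t + r + 1)
      - gap_cost T L PDT CU (t - 1 - l) (t + r + 1)"
proof -
  have "t - 1 - (t - 1 - l) = l" "t + r - (t - 1 - l) = l + r + 1" using assms by auto
  then show ?thesis using assms by (auto simp: delta_def gap_cost_def add.commute)
qed

text \<open>The neighbours are moved one at a time, the right one with \<open>i\<close> fixed and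
  the left one with \<open>k'\<close> fixed. Each move compares two increments of \<open>CU\<close>
  of equal width, so strict concavity decides. If \<open>k' = T + 1\<close>, the costs of reaching
  \<open>k'\<close> vanish and strict growth of \<open>CU\<close> decides.\<close>

lemma gap_cost_strict_monge:
  assumes L: "\<And>t. t \<in> {1..T} \<Longrightarrow> 0 < L t" and PDT: "0 \<le> PDT"
    and mono: "mono_on {0..} CU" and strict: "strictly_concave_on {0..} CU"
  shows "strict_monge (gap_cost T L PDT CU) (Suc T)"
proof
  fix i' i x k k' :: nat
  assume h: "i' \<le> i" "i < x" "x < k" "k \<le> k'" "k' \<le> Suc T" "i' \<noteq> i \<or> k' \<noteq> k"
  let ?c = "gap_cost T L PDT CU" and ?d = "gap_length L PDT"
  have nn: "0 \<le> ?d i k" if "k \<le> Suc T" for i k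
    using L PDT that by (rule gap_length_nonneg)
  have x: "0 < L x" "x \<le> T" using L[of x] h by auto
  have left: "?c i x + ?c x k' - ?c i k' < ?c i' x + ?c x k' - ?c i' k'" if "i' < i"
  proof -
    have "0 < L i" using L[of i] h that by auto
    moreover have "?d i' x = ?d i' i + L i + ?d i x" using h that by (intro gap_length_split) auto
    ultimately have lt: "?d i x < ?d i' x" using nn[of i i'] x h by auto
    show ?thesis
    proof (cases "k' \<le> T")
      case True
      have "CU (?d i' x + (L x + ?d x k')) - CU (?d i' x)
          < CU (?d i x + (L x + ?d x k')) - CU (?d i x)"
        using lt nn[of x i] nn[of k' x] x h
        by (intro strictly_concave_increments[OF strict]) auto
      then show ?thesis using True h x
        by (simp add: gap_cost_eq gap_length_split[of _ x k'] add.assoc)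
    next
      case False
      then show ?thesis using h x lt nn[of x i] that
        by (simp add: gap_cost_eq strictly_concave_mono_strict[OF strict mono])
    qed
  qed
  have right: "?c i x + ?c x k - ?c i k < ?c i x + ?c x k' - ?c i k'" if "k < k'"
  proof (cases "k' \<le> T")
    case True
    have "0 < L k" using L[of k] h that True by auto
    moreover have "?d x k' = ?d x k + L k + ?d k k'" using h that by (intro gap_length_split) auto
    ultimately have lt: "?d x k < ?d x k'" using nn[of k' k] h by auto
    have "CU (?d x k' + (?d i x + L x)) - CU (?d x k')
        < CU (?d x k + (?d i x + L x)) - CU (?d x k)"
      using lt nn[of k x] nn[of x i] x h
      by (intro strictly_concave_increments[OF strict]) auto
    then show ?thesis using True h x that
      by (simp add: gap_cost_eq gap_length_split[of i x] algebra_simps)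
  next
    case False
    have "CU (?d x k) < CU (?d i x + L x + ?d x k)"
      using nn[of k x] nn[of x i] x h that False
      by (intro strictly_concave_mono_strict[OF strict mono]) auto
    then show ?thesis using False h x that
      by (simp add: gap_cost_eq gap_length_split[of i x])
  qed
  show "?c i x + ?c x k - ?c i k < ?c i' x + ?c x k' - ?c i' k'"
    using left right h by (cases "i' < i"; cases "k < k'") auto
qed

section \<open>Tree inequalities and start-up costs in terms of gaps\<close>

lemma subtrees_set_tree: "S \<in> subtrees B \<Longrightarrow> set_tree S \<subseteq> set_tree B"
  by (induction B) auto

text \<open>Distinct labels place a label in only one subtree, so the definite description can be
  evaluated by descending the tree.\<close>

lemma subtree_at_Node:
  assumes "distinct (inorder (Node l x r))"
  shows "subtree_at (Node l x r) x = Node l x r"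
    and "t \<in> set_tree l \<Longrightarrow> subtree_at (Node l x r) t = subtree_at l t"
    and "t \<in> set_tree r \<Longrightarrow> subtree_at (Node l x r) t = subtree_at r t"
proof -
  have d: "x \<notin> set_tree l" "x \<notin> set_tree r" "set_tree l \<inter> set_tree r = {}"
    using assms by auto
  have v: "value S \<in> set_tree B" if "S \<in> subtrees B" "S \<noteq> Leaf" for S and B :: "'a tree"
    using subtrees_set_tree[OF that(1)] that(2) by (cases S) auto
  show "subtree_at (Node l x r) x = Node l x r"
    unfolding subtree_at_def using v d by (intro the_equality) auto
  show "subtree_at (Node l x r) t = subtree_at l t" if "t \<in> set_tree l"
    unfolding subtree_at_def using v d that
    by (intro arg_cong[of _ _ The] ext) auto
  show "subtree_at (Node l x r) t = subtree_at r t" if "t \<in> set_tree r"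
    unfolding subtree_at_def using v d that
    by (intro arg_cong[of _ _ The] ext) auto
qed

lemma upt_split: "i \<le> j \<Longrightarrow> j < k \<Longrightarrow> [i..<k] = [i..<j] @ j # [Suc j..<k]"
  using upt_add_eq_append[of i j "k - j"] by (simp add: upt_conv_Cons)

text \<open>The labels of a subtree are the consecutive numbers strictly between \<open>lo\<close>
  and \<open>hi\<close>. Hence its root \<open>x\<close> has \<open>x - 1 - lo\<close> nodes to the
  left and \<open>hi - 1 - x\<close> to the right, and these counts encode the gap.\<close>

lemma sum_delta_tree_val:
  assumes "inorder B = [Suc lo..<hi]" "lo < hi" "hi \<le> Suc T"
  shows "(\<Sum>t\<in>set_tree B. delta T L PDT CU t (left_nodes B t) (right_nodes B t) * v t) =
    tree_val (gap_cost T L PDT CU) v lo hi B"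
  using assms
proof (induction B arbitrary: lo hi)
  case Leaf
  then show ?case by simp
next
  case (Node l x r)
  have split: "inorder l @ x # inorder r = [Suc lo..<hi]" using Node.prems by simp
  have "x \<in> set [Suc lo..<hi]" by (simp flip: split)
  then have x: "lo < x" "x < hi" by auto
  have "[Suc lo..<hi] = [Suc lo..<x] @ x # [Suc x..<hi]"
    using x by (intro upt_split) auto
  moreover have dist: "distinct (inorder (Node l x r))" using Node.prems by simp
  moreover have "x \<notin> set (inorder l)" "x \<notin> set (inorder r)" using dist by auto
  ultimately have io: "inorder l = [Suc lo..<x]" "inorder r = [Suc x..<hi]"
    using split by (auto simp: append_Cons_eq_iff)
  have sz: "size l = x - 1 - lo" "size r = hi - 1 - x"
    using io by (metis length_inorder length_upt diff_Suc_eq_diff_pred diff_commute diff_Suc_1)+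
  have d: "x \<notin> set_tree l" "x \<notin> set_tree r" "set_tree l \<inter> set_tree r = {}"
    using dist by auto
  let ?s = "\<lambda>B t. delta T L PDT CU t (left_nodes B t) (right_nodes B t) * v t"
  have "(\<Sum>t\<in>set_tree (Node l x r). ?s (Node l x r) t) =
      ?s (Node l x r) x + (\<Sum>t\<in>set_tree l. ?s (Node l x r) t) + (\<Sum>t\<in>set_tree r. ?s (Node l x r) t)"
    using d by (simp add: sum.union_disjoint)
  also have "(\<Sum>t\<in>set_tree l. ?s (Node l x r) t) = (\<Sum>t\<in>set_tree l. ?s l t)"
    by (intro sum.cong) (simp_all add: left_nodes_def right_nodes_def subtree_at_Node[OF dist])
  also have "\<dots> = tree_val (gap_cost T L PDT CU) v lo x l"
    using io x Node.prems by (intro Node.IH) auto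
  also have "(\<Sum>t\<in>set_tree r. ?s (Node l x r) t) = (\<Sum>t\<in>set_tree r. ?s r t)"
    by (intro sum.cong) (simp_all add: left_nodes_def right_nodes_def subtree_at_Node[OF dist])
  also have "\<dots> = tree_val (gap_cost T L PDT CU) v x hi r"
    using io x Node.prems by (intro Node.IH) auto
  also have "?s (Node l x r) x = (gap_cost T L PDT CU lo x + gap_cost T L PDT CU x hi
      - gap_cost T L PDT CU lo hi) * v x"
  proof -
    have "delta T L PDT CU x (x - 1 - lo) (hi - 1 - x) = gap_cost T L PDT CU lo x
        + gap_cost T L PDT CU x hi - gap_cost T L PDT CU lo hi"
      using x Node.prems delta_eq_gap_cost[of "x - 1 - lo" x "hi - 1 - x" T L PDT CU] by simp
    then show ?thesis by (simp add: left_nodes_def right_nodes_def subtree_at_Node[OF dist] sz)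
  qed
  finally show ?case by simp
qed

lemma ol_eq_last:
  assumes "\<And>t. at_period v t \<in> {0, 1}" "0 < t"
  shows "ol t v = t - 1 - last (0 # filter (\<lambda>s. at_period v s = 1) [1..<t])"
proof -
  \<comment> \<open>The last online period before \<open>t\<close>; the prepended \<open>0\<close>
    is the default if there is none.\<close>
  define p where "p = last (0 # filter (\<lambda>s. at_period v s = 1) [1..<t])"
  have "p \<in> set (0 # filter (\<lambda>s. at_period v s = 1) [1..<t])"
    unfolding p_def by (rule last_in_set) simp
  then have p: "p < t" "p = 0 \<or> at_period v p = 1" using assms(2) by auto
  have gap: "at_period v s = 0" if "p < s" "s < t" for s
  proof (rule ccontr)
    assume "at_period v s \<noteq> 0"
    then have s: "at_period v s = 1" using assms(1)[of s] by auto
    have "[1..<t] = [1..<s] @ s # [Suc s..<t]"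
      using that by (intro upt_split) auto
    then have "s \<le> p" unfolding p_def using s by (auto dest!: last_in_set)
    then show False using that by simp
  qed
  show ?thesis unfolding p_def[symmetric] ol_def
  proof (rule Max_eqI)
    fix l assume l: "l \<in> {l \<in> {0..t - 1}. \<forall>j\<in>{1..l}. at_period v (t - j) = 0}"
    show "l \<le> t - 1 - p"
    proof (rule ccontr)
      assume "\<not> l \<le> t - 1 - p"
      then have "t - p \<in> {1..l}" "p \<noteq> 0" using l p by auto
      then have "at_period v (t - (t - p)) = 0" using l by blast
      then show False using p \<open>p \<noteq> 0\<close> by simp
    qed
  next
    show "t - 1 - p \<in> {l \<in> {0..t - 1}. \<forall>j\<in>{1..l}. at_period v (t - j) = 0}"
      using p by (auto intro!: gap)
  qed simp
qed

lemma DCU_sum_path_cost: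
  fixes v :: "real ^ 'n::{finite,linorder}"
  assumes "\<And>t. at_period v t \<in> {0, 1}"
  shows "DCU_sum L PDT CU v = path_cost (gap_cost (CARD('n)) L PDT CU) 0
    (filter (\<lambda>t. at_period v t = 1) [1..<Suc (CARD('n))]) (Suc (CARD('n)))"
proof -
  let ?c = "gap_cost (CARD('n)) L PDT CU" and ?F = "\<lambda>n. filter (\<lambda>t. at_period v t = 1) [1..<Suc n]"
  \<comment> \<open>The next stop \<open>k\<close> stays arbitrary because an online period
    \<open>n + 1\<close> becomes the next stop in the induction. In the end \<open>k\<close> is
    \<open>T + 1\<close>, which is reached at no cost.\<close>
  have "path_cost ?c 0 (?F n) k = (\<Sum>t=1..n. DCU L PDT CU t v) + ?c (last (0 # ?F n)) k"
    if "n \<le> CARD('n)" for n k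
    using that
  proof (induction n arbitrary: k)
    case 0
    then show ?case by simp
  next
    case (Suc n)
    show ?case
    proof (cases "at_period v (Suc n) = 1")
      case True
      then have F: "?F (Suc n) = ?F n @ [Suc n]" by simp
      have "DCU L PDT CU (Suc n) v = ?c (last (0 # ?F n)) (Suc n)"
        using True Suc.prems ol_eq_last[OF assms, of "Suc n"] by (simp add: DCU_def gap_cost_def)
      then show ?thesis unfolding F using Suc by (simp add: path_cost_append)
    next
      case False
      then have F: "?F (Suc n) = ?F n" by simp
      show ?thesis unfolding F using Suc False by (simp add: DCU_def)
    qed
  qed
  from this[of "CARD('n)" "Suc (CARD('n))"] show ?thesis
    by (simp add: DCU_sum_def gap_cost_def)
qed

section \<open>Periods as ranks of vector indices\<close>

text \<open>The rank of an index is strictly increasing, hence injective, and counting gives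
  surjectivity. This makes \<open>period\<close> the inverse of the rank.\<close>

lemma bij_betw_card_atMost:
  "bij_betw (\<lambda>i::'n::{finite,linorder}. card {..i}) UNIV {1..CARD('n)}"
proof -
  have lt: "card {..i} < card {..j}" if "i < j" for i j :: 'n
    using that by (intro psubset_card_mono) auto
  have inj: "inj (\<lambda>i::'n. card {..i})"
    by (rule injI) (metis lt less_irrefl linorder_neqE)
  have "card {..i} \<in> {1..CARD('n)}" for i :: 'n
    using card_gt_0_iff[of "{..i}"] card_mono[of UNIV "{..i}"] by (auto simp: Suc_le_eq)
  then have "range (\<lambda>i::'n. card {..i}) = {1..CARD('n)}"
    using card_image[OF inj] by (intro card_subset_eq) auto
  then show ?thesis using inj by (simp add: bij_betw_def)
qed

lemma period_card_atMost: "period (card {..i}) = (i :: 'n::{finite,linorder})"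
  unfolding period_def using bij_betw_card_atMost[where 'n='n]
  by (intro the_equality) (auto simp: bij_betw_def inj_def)

lemma at_period_vec:
  assumes "t \<in> {1..CARD('n)}"
  shows "at_period (\<chi> i::'n::{finite,linorder}. w (card {..i})) t = w t"
proof -
  have "t \<in> range (\<lambda>i::'n. card {..i})"
    using assms bij_betw_card_atMost[where 'n='n] by (simp add: bij_betw_def)
  then obtain i :: 'n where "t = card {..i}" by blast
  then show ?thesis by (simp add: at_period_def period_card_atMost)
qed

lemma all_periods_iff:
  fixes v :: "real ^ 'n::{finite,linorder}"
  shows "(\<forall>t\<in>{1..CARD('n)}. Q (at_period v t)) \<longleftrightarrow> (\<forall>i. Q (v $ i))"
proof -
  have "{1..CARD('n)} = range (\<lambda>i::'n. card {..i})"
    using bij_betw_card_atMost[where 'n='n] by (simp add: bij_betw_def)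
  then show ?thesis by (simp add: at_period_def period_card_atMost)
qed

lemma at_period_binary: "v \<in> binary_vectors \<Longrightarrow> at_period v t \<in> {0, 1}"
  by (simp add: binary_vectors_def at_period_def)

lemma at_period_linear:
  "at_period (a *\<^sub>R u + b *\<^sub>R w) = (\<lambda>t. a * at_period u t + b * at_period w t)"
  by (simp add: at_period_def fun_eq_iff)

lemma set_tree_rank_labeled: "B \<in> rank_labeled_trees T \<Longrightarrow> set_tree B = {1..T}"
  by (auto simp: rank_labeled_trees_def simp flip: set_inorder simp del: upt_Suc)

section \<open>The convex hull as the solution set\<close>

lemma mem_solutions_iff:
  fixes v :: "real ^ 'n::{finite,linorder}"
  assumes "\<B> \<subseteq> rank_labeled_trees (CARD('n))"
  shows "(v, a) \<in> solutions L PDT CU \<B> P Q \<longleftrightarrow>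
    (\<forall>B\<in>\<B>. tree_val (gap_cost (CARD('n)) L PDT CU) (at_period v) 0 (Suc (CARD('n))) B \<le> a) \<and>
    (\<forall>t\<in>P. 0 \<le> at_period v t) \<and> (\<forall>t\<in>Q. at_period v t \<le> 1)"
proof -
  have "(\<Sum>t=1..CARD('n). delta (CARD('n)) L PDT CU t (left_nodes B t) (right_nodes B t)
      * at_period v t) = tree_val (gap_cost (CARD('n)) L PDT CU) (at_period v) 0 (Suc (CARD('n))) B"
    if "B \<in> \<B>" for B
  proof -
    have B: "B \<in> rank_labeled_trees (CARD('n))" using assms that by blast
    then have "inorder B = [Suc 0..<Suc (CARD('n))]" by (simp add: rank_labeled_trees_def)
    from sum_delta_tree_val[OF this] show ?thesis
      by (simp add: set_tree_rank_labeled[OF B])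
  qed
  then show ?thesis by (simp add: solutions_def)
qed

lemma convex_solutions:
  assumes "\<B> \<subseteq> rank_labeled_trees (CARD('n::{finite,linorder}))"
  shows "convex (solutions L PDT CU \<B> P Q :: ((real, 'n) vec \<times> real) set)"
proof (rule convexI)
  fix x y :: "(real, 'n) vec \<times> real" and p q :: real
  assume xy: "x \<in> solutions L PDT CU \<B> P Q" "y \<in> solutions L PDT CU \<B> P Q"
    and pq: "0 \<le> p" "0 \<le> q" "p + q = 1"
  obtain v a w b where x: "x = (v, a)" and y: "y = (w, b)" by (cases x, cases y)
  have mono: "p * r + q * s \<le> p * r' + q * s'" if "r \<le> r'" "s \<le> s'" for r r' s s' :: real
    using that pq by (intro add_mono mult_left_mono)
  have "p * r + q * s \<le> 1" if "r \<le> 1" "s \<le> 1" for r s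
    using mono[OF that] pq by simp
  then show "p *\<^sub>R x + q *\<^sub>R y \<in> solutions L PDT CU \<B> P Q"
    using xy pq mono
    by (simp add: x y mem_solutions_iff[OF assms] at_period_linear tree_val_add tree_val_scale)
qed

text \<open>The constant in the bound for binary vectors is the cost of the gap from
  \<open>0\<close> to \<open>T + 1\<close>, which is zero.\<close>

lemma tree_val_DCU_sum:
  fixes v :: "real ^ 'n::{finite,linorder}"
  assumes "strict_monge (gap_cost (CARD('n)) L PDT CU) (Suc (CARD('n)))"
    and "v \<in> binary_vectors" "B \<in> rank_labeled_trees (CARD('n))"
  shows "tree_val (gap_cost (CARD('n)) L PDT CU) (at_period v) 0 (Suc (CARD('n))) B
      \<le> DCU_sum L PDT CU v \<and>
    (tree_val (gap_cost (CARD('n)) L PDT CU) (at_period v) 0 (Suc (CARD('n))) B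
      = DCU_sum L PDT CU v \<longleftrightarrow> heap_ordered (at_period v) B)"
proof -
  have bin: "at_period v t \<in> {0, 1}" for t using assms(2) by (rule at_period_binary)
  have io: "inorder B = [1..<Suc (CARD('n))]"
    using assms(3) by (simp add: rank_labeled_trees_def)
  have "gap_cost (CARD('n)) L PDT CU 0 (Suc (CARD('n))) = 0" by (simp add: gap_cost_def)
  moreover have "sorted_wrt (<) (0 # inorder B @ [Suc (CARD('n))])"
    unfolding io by (auto simp: sorted_wrt_append)
  ultimately show ?thesis
    using strict_monge.tree_val_binary[OF assms(1), of 0 B "Suc (CARD('n))" "at_period v"] bin
    by (simp add: DCU_sum_path_cost[OF bin] io)
qed

text \<open>
  Peels off the smallest positive level \<open>m\<close> of \<open>v\<close>: it is a convex combination of the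
  indicator of its support and of a vector with fewer fractional entries, and both are ordered
  like \<open>v\<close>, so that the value of the tree is affine along the decomposition.
\<close>

lemma heap_ordered_in_hull:
  fixes v :: "real ^ 'n::{finite,linorder}"
  assumes "strict_monge (gap_cost (CARD('n)) L PDT CU) (Suc (CARD('n)))"
    and B: "B \<in> rank_labeled_trees (CARD('n))"
    and "v \<in> unit_cube" "heap_ordered (at_period v) B"
    and "tree_val (gap_cost (CARD('n)) L PDT CU) (at_period v) 0 (Suc (CARD('n))) B \<le> a"
  shows "(v, a) \<in> convex hull (epigraph binary_vectors (DCU_sum L PDT CU))"
  using assms(3-5)
proof (induction "card {i. 0 < v $ i \<and> v $ i < 1}" arbitrary: v a rule: less_induct)
  case less
  let ?val = "\<lambda>v. tree_val (gap_cost (CARD('n)) L PDT CU) (at_period v) 0 (Suc (CARD('n))) B"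
  let ?hull = "convex hull (epigraph binary_vectors (DCU_sum L PDT CU))
    :: ((real, 'n) vec \<times> real) set"
  have base: "(w, b) \<in> ?hull"
    if "w \<in> binary_vectors" "heap_ordered (at_period w) B" "?val w \<le> b" for w :: "(real, 'n) vec" and b
    using that tree_val_DCU_sum[OF assms(1) that(1) B]
    by (intro hull_inc) (simp add: epigraph_def)
  have cube: "0 \<le> v $ i" "v $ i \<le> 1" for i
    using less.prems(1) by (auto simp: unit_cube_def)
  define Fr where "Fr = {i. 0 < v $ i \<and> v $ i < 1}"
  show ?case
  proof (cases "Fr = {}")
    case True
    then have "v $ i = 0 \<or> v $ i = 1" for i
      using cube[of i] by (auto simp: Fr_def less_le)
    then show ?thesis using less.prems by (intro base) (auto simp: binary_vectors_def)
  next
    case False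
    define m where "m = Min ((\<lambda>i. v $ i) ` Fr)"
    have "m \<in> (\<lambda>i. v $ i) ` Fr" unfolding m_def using False by (intro Min_in) auto
    then obtain i0 where i0: "v $ i0 = m" "0 < m" "m < 1" by (auto simp: Fr_def)
    have m_le: "m \<le> v $ i" if "0 < v $ i" for i
    proof (cases "v $ i < 1")
      case True
      then show ?thesis unfolding m_def using that by (intro Min_le) (auto simp: Fr_def)
    qed (use i0 in simp)
    define up where "up y = (if 0 < y then 1 else 0 :: real)" for y :: real
    \<comment> \<open>Level \<open>m\<close> goes to \<open>0\<close>, while \<open>0\<close> and
      \<open>1\<close> stay fixed. So the entry \<open>i0\<close> stops being fractional and no new
      fractional entry arises.\<close>
    define dn where "dn y = (if 0 < y then (y - m) / (1 - m) else 0)" for y :: real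
    define s where "s = (\<chi> i. up (v $ i))"
    define w where "w = (\<chi> i. dn (v $ i))"
    have comb: "v = m *\<^sub>R s + (1 - m) *\<^sub>R w"
      using i0 cube by (auto simp: vec_eq_iff s_def w_def up_def dn_def less_le)
    have heap: "heap_ordered (at_period s) B" "heap_ordered (at_period w) B"
    proof -
      have "up y \<le> up x" "dn y \<le> dn x" if "x \<in> range (\<lambda>i. v $ i)" "y \<le> x" for x y
        using that i0 m_le by (auto simp: up_def dn_def intro!: divide_right_mono divide_nonneg_pos)
      then show "heap_ordered (at_period s) B" "heap_ordered (at_period w) B"
        using heap_ordered_mono[OF less.prems(2)] by (auto simp: s_def w_def at_period_def)
    qed
    \<comment> \<open>Both parts keep the slack of \<open>a\<close> over the tree value, so that
      their combination returns exactly \<open>a\<close>.\<close>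
    define d where "d = a - ?val v"
    have d: "0 \<le> d" using less.prems(3) by (simp add: d_def)
    have "?val v = m * ?val s + (1 - m) * ?val w"
      by (subst comb) (simp add: at_period_linear tree_val_add tree_val_scale)
    then have a: "a = m * (?val s + d) + (1 - m) * (?val w + d)"
      by (simp add: d_def algebra_simps)
    have "(s, ?val s + d) \<in> ?hull"
      using heap d by (intro base) (auto simp: binary_vectors_def s_def up_def)
    moreover have "(w, ?val w + d) \<in> ?hull"
    proof (rule less.hyps)
      have "{i. 0 < w $ i \<and> w $ i < 1} \<subset> Fr"
      proof
        show "{i. 0 < w $ i \<and> w $ i < 1} \<subseteq> Fr"
          using i0 by (auto simp: w_def dn_def Fr_def split: if_splits)
        have "i0 \<in> Fr" "\<not> 0 < w $ i0" using i0 by (auto simp: Fr_def w_def dn_def)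
        then show "{i. 0 < w $ i \<and> w $ i < 1} \<noteq> Fr" by auto
      qed
      then show "card {i. 0 < w $ i \<and> w $ i < 1} < card {i. 0 < v $ i \<and> v $ i < 1}"
        unfolding Fr_def[symmetric] by (intro psubset_card_mono) auto
      show "w \<in> unit_cube"
        using i0 m_le cube by (auto simp: unit_cube_def w_def dn_def)
    qed (use heap(2) d in simp_all)
    ultimately have "m *\<^sub>R (s, ?val s + d) + (1 - m) *\<^sub>R (w, ?val w + d) \<in> ?hull"
      using i0 by (intro convexD[OF convex_convex_hull]) auto
    then show ?thesis using a comb by simp
  qed
qed

text \<open>The inequalities hold at binary vectors, and the solution set is convex. Conversely, a
  solution satisfies the inequality of a tree on which its vector is heap ordered, and this one
  suffices for membership in the hull.\<close>

lemma convex_hull_eq_solutions: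
  assumes "strict_monge (gap_cost (CARD('n::{finite,linorder})) L PDT CU) (Suc (CARD('n)))"
  shows "convex hull (epigraph binary_vectors (DCU_sum L PDT CU)) =
    (solutions L PDT CU (rank_labeled_trees (CARD('n))) {1..CARD('n)} {1..CARD('n)}
      :: ((real, 'n) vec \<times> real) set)" (is "?H = ?S")
proof
  have mem: "(v, a) \<in> ?S \<longleftrightarrow> v \<in> unit_cube \<and> (\<forall>B\<in>rank_labeled_trees (CARD('n)).
      tree_val (gap_cost (CARD('n)) L PDT CU) (at_period v) 0 (Suc (CARD('n))) B \<le> a)"
    for v :: "(real, 'n) vec" and a
    unfolding mem_solutions_iff[OF subset_refl]
    using all_periods_iff[of "\<lambda>x. 0 \<le> x" v] all_periods_iff[of "\<lambda>x. x \<le> 1" v]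
    by (auto simp: unit_cube_def)
  have "(v, a) \<in> ?S" if "(v, a) \<in> epigraph binary_vectors (DCU_sum L PDT CU)"
    for v :: "(real, 'n) vec" and a
  proof -
    have v: "v \<in> binary_vectors" and a: "DCU_sum L PDT CU v \<le> a"
      using that by (auto simp: epigraph_def)
    have "v \<in> unit_cube" using v by (auto simp: binary_vectors_def unit_cube_def) (metis order_refl zero_le_one)+
    then show ?thesis unfolding mem using tree_val_DCU_sum[OF assms v] a by force
  qed
  then show "?H \<subseteq> ?S" by (intro hull_minimal convex_solutions) auto
  show "?S \<subseteq> ?H"
  proof
    fix x assume x: "x \<in> ?S"
    obtain v a where va: "x = (v, a)" by (cases x)
    obtain B where B: "inorder B = [1..<CARD('n) + 1]" "heap_ordered (at_period v) B"
      using heap_ordered_exists by blast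
    then have "B \<in> rank_labeled_trees (CARD('n))" by (simp add: rank_labeled_trees_def)
    then show "x \<in> ?H" using x B unfolding va mem
      by (intro heap_ordered_in_hull[OF assms]) auto
  qed
qed

text \<open>This justifies the definite description. A function with this epigraph is the value of
  some tree heap ordered by the argument; uniqueness holds on the cube by the epigraph and outside
  by extensionality.\<close>

lemma epigraph_LCU_sum:
  assumes "strict_monge (gap_cost (CARD('n::{finite,linorder})) L PDT CU) (Suc (CARD('n)))"
  shows "epigraph unit_cube (LCU_sum L PDT CU :: (real, 'n) vec \<Rightarrow> real) =
    convex hull (epigraph binary_vectors (DCU_sum L PDT CU))" (is "_ = ?H")
proof -
  let ?val = "\<lambda>B v :: (real, 'n) vec.
    tree_val (gap_cost (CARD('n)) L PDT CU) (at_period v) 0 (Suc (CARD('n))) B"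
  define h where "h v = (SOME B. inorder B = [1..<CARD('n) + 1] \<and>
    heap_ordered (at_period v) B)" for v :: "(real, 'n) vec"
  have "inorder (h v) = [1..<CARD('n) + 1] \<and> heap_ordered (at_period v) (h v)" for v
    unfolding h_def by (rule someI_ex) (rule heap_ordered_exists)
  then have h: "h v \<in> rank_labeled_trees (CARD('n))" "heap_ordered (at_period v) (h v)" for v
    by (simp_all add: rank_labeled_trees_def)
  define f where "f = restrict (\<lambda>v. ?val (h v) v) (unit_cube :: (real, 'n) vec set)"
  have mem: "(v, a) \<in> ?H \<longleftrightarrow> v \<in> unit_cube \<and> f v \<le> a" for v a
  proof
    assume "(v, a) \<in> ?H"
    then have "(\<forall>t\<in>{1..CARD('n)}. 0 \<le> at_period v t)" "(\<forall>t\<in>{1..CARD('n)}. at_period v t \<le> 1)"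
      and le: "?val (h v) v \<le> a"
      unfolding convex_hull_eq_solutions[OF assms] mem_solutions_iff[OF subset_refl]
      using h by auto
    then have "v \<in> unit_cube"
      using all_periods_iff[of "\<lambda>x. 0 \<le> x" v] all_periods_iff[of "\<lambda>x. x \<le> 1" v]
      by (simp add: unit_cube_def)
    then show "v \<in> unit_cube \<and> f v \<le> a" using le by (simp add: f_def)
  next
    assume "v \<in> unit_cube \<and> f v \<le> a"
    then show "(v, a) \<in> ?H"
      using h by (intro heap_ordered_in_hull[OF assms, of "h v"]) (auto simp: f_def)
  qed
  let ?P = "\<lambda>g. g \<in> extensional unit_cube \<and> epigraph unit_cube g = ?H"
  have "LCU_sum L PDT CU = f" unfolding LCU_sum_def
  proof (rule the_equality)
    show "?P f" using mem by (auto simp: f_def epigraph_def)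
    fix g assume g: "?P g"
    have iff: "g v \<le> a \<longleftrightarrow> f v \<le> a" if "v \<in> unit_cube" for v a
    proof -
      have "(v, a) \<in> epigraph unit_cube g \<longleftrightarrow> f v \<le> a" using g mem[of v a] that by simp
      then show ?thesis using that by (simp add: epigraph_def)
    qed
    have "g v = f v" if "v \<in> unit_cube" for v
      using iff[OF that] by (meson order_antisym order_refl)
    then show "g = f"
      using g by (intro extensionalityI[of g unit_cube f]) (auto simp: f_def)
  qed
  then show ?thesis using mem by (auto simp: epigraph_def)
qed

section \<open>Irredundancy of the inequalities\<close>

text \<open>On each binary vector heap ordered on \<open>B\<close>, the value of \<open>B\<close>
  equals the start-up cost and no tree exceeds it. Another tree falls short on at least one of these
  vectors, since they determine \<open>B\<close>. Tree values are linear, so the average separates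
  \<open>B\<close> from all others.\<close>

lemma tree_strict_maximum:
  assumes "strict_monge (gap_cost (CARD('n::{finite,linorder})) L PDT CU) (Suc (CARD('n)))"
    and B: "B \<in> rank_labeled_trees (CARD('n))"
  obtains v :: "(real, 'n::{finite,linorder}) vec" where "v \<in> unit_cube"
    and "\<And>B'. \<lbrakk>B' \<in> rank_labeled_trees (CARD('n)); B' \<noteq> B\<rbrakk> \<Longrightarrow>
      tree_val (gap_cost (CARD('n)) L PDT CU) (at_period v) 0 (Suc (CARD('n))) B' <
      tree_val (gap_cost (CARD('n)) L PDT CU) (at_period v) 0 (Suc (CARD('n))) B"
proof -
  let ?val = "\<lambda>v. tree_val (gap_cost (CARD('n)) L PDT CU) v 0 (Suc (CARD('n)))"
  define A where "A = {S. S \<subseteq> {1..CARD('n)} \<and> heap_ordered (indicator S) B}"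
  define e where "e S = (\<chi> i::'n. (indicator S (card {..i}) :: real))" for S
  have e: "at_period (e S) t = indicator S t" if "t \<in> {1..CARD('n)}" for S t
    unfolding e_def using that by (rule at_period_vec)
  have bin: "e S \<in> binary_vectors" for S by (simp add: e_def binary_vectors_def indicator_def)
  have ord: "heap_ordered (at_period (e S)) B' \<longleftrightarrow> heap_ordered (indicator S) B'"
    if "B' \<in> rank_labeled_trees (CARD('n))" for S B'
    using e set_tree_rank_labeled[OF that] by (intro heap_ordered_cong) simp
  have finA: "finite A" unfolding A_def by (rule finite_subset[of _ "Pow {1..CARD('n)}"]) auto
  have "heap_ordered (indicator {}) t" for t :: "nat tree" by (induction t) auto
  \<comment> \<open>This makes the average over \<open>A\<close> meaningful.\<close>
  then have "{} \<in> A" by (simp add: A_def)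
  then have cardA: "0 < card A" using finA by (auto simp: card_gt_0_iff)
  define v where "v = (1 / card A) *\<^sub>R (\<Sum>S\<in>A. e S)"
  have "0 \<le> v $ i \<and> v $ i \<le> 1" for i
  proof -
    have "(\<Sum>S\<in>A. e S $ i) \<le> (\<Sum>S\<in>A. 1)"
      by (intro sum_mono) (simp add: e_def indicator_def)
    moreover have "0 \<le> (\<Sum>S\<in>A. e S $ i)"
      by (intro sum_nonneg) (simp add: e_def indicator_def)
    ultimately show ?thesis using cardA by (simp add: v_def field_simps)
  qed
  then have cube: "v \<in> unit_cube" by (simp add: unit_cube_def)
  have "at_period v = (\<lambda>t. (1 / card A) * (\<Sum>S\<in>A. at_period (e S) t))"
    by (simp add: v_def at_period_def fun_eq_iff)
  then have val: "?val (at_period v) B' = (1 / card A) * (\<Sum>S\<in>A. ?val (at_period (e S)) B')" for B'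
    by (simp only: tree_val_scale tree_val_sum)
  have "?val (at_period v) B' < ?val (at_period v) B"
    if B': "B' \<in> rank_labeled_trees (CARD('n))" "B' \<noteq> B" for B'
  proof -
    have eqB: "?val (at_period (e S)) B = DCU_sum L PDT CU (e S)" if "S \<in> A" for S
      using tree_val_DCU_sum[OF assms(1) bin B] ord[OF B] that by (simp add: A_def)
    have "\<exists>S\<in>A. \<not> heap_ordered (indicator S) B'"
    proof (rule ccontr)
      assume "\<not> ?thesis"
      then have "B' = B"
        using B B' set_tree_rank_labeled[OF B]
        by (intro heap_ordered_unique) (auto simp: A_def rank_labeled_trees_def)
      then show False using B' by simp
    qed
    then obtain S where S: "S \<in> A" "\<not> heap_ordered (indicator S) B'" by blast
    have "(\<Sum>S\<in>A. ?val (at_period (e S)) B') < (\<Sum>S\<in>A. ?val (at_period (e S)) B)"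
    proof (rule sum_strict_mono_ex1[OF finA])
      show "\<forall>S\<in>A. ?val (at_period (e S)) B' \<le> ?val (at_period (e S)) B"
        using tree_val_DCU_sum[OF assms(1) bin B'(1)] eqB by simp
      show "\<exists>S\<in>A. ?val (at_period (e S)) B' < ?val (at_period (e S)) B"
        using tree_val_DCU_sum[OF assms(1) bin B'(1), of S] eqB[OF S(1)] ord[OF B'(1), of S] S
        by (intro bexI[of _ S]) auto
    qed
    then show ?thesis unfolding val using cardA by (simp add: divide_strict_right_mono)
  qed
  then show thesis using that cube by blast
qed

lemma finite_rank_labeled_trees: "finite (rank_labeled_trees T)"
  unfolding rank_labeled_trees_def by (rule finite_trees_inorder)

text \<open>There are only finitely many trees, so a large \<open>a\<close> meets all their
  inequalities. A value \<open>x\<close> outside the unit interval then leaves a bound of period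
  \<open>t\<close> as the only one that fails.\<close>

lemma period_bound_violated:
  fixes x :: real
  assumes "t \<in> {1..CARD('n::{finite,linorder})}"
  obtains v :: "(real, 'n::{finite,linorder}) vec" and a where "at_period v t = x"
    and "\<And>s. s \<in> {1..CARD('n)} \<Longrightarrow> s \<noteq> t \<Longrightarrow> at_period v s = 0"
    and "\<And>B. B \<in> rank_labeled_trees (CARD('n)) \<Longrightarrow> tree_val c (at_period v) lo hi B \<le> a"
proof -
  define v where "v = (\<chi> i::'n. (\<lambda>s. if s = t then x else 0) (card {..i}))"
  have v: "at_period v s = (if s = t then x else 0)" if "s \<in> {1..CARD('n)}" for s
    unfolding v_def using that by (rule at_period_vec)
  let ?A = "(\<lambda>B. tree_val c (at_period v) lo hi B) ` rank_labeled_trees (CARD('n))"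
  have "bdd_above ?A"
    using finite_rank_labeled_trees by (intro bdd_above_finite) simp
  then obtain a where "\<And>B. B \<in> rank_labeled_trees (CARD('n)) \<Longrightarrow> tree_val c (at_period v) lo hi B \<le> a"
    by (meson bdd_above.E imageI)
  then show thesis using that[of v a] v assms by simp
qed

theorem theorem6p7:
  fixes L :: "nat \<Rightarrow> real" and PDT :: real and CU :: "real \<Rightarrow> real" and T :: nat
    and epi_LCU :: "((real ^ 'n::{finite,linorder}) \<times> real) set"
  assumes T: "T = CARD('n)"
    and L_pos: "\<And>t. t \<in> {1..T} \<Longrightarrow> 0 < L t"
    and PDT_nonneg: "0 \<le> PDT"
    and CU_nonneg: "\<And>x. 0 \<le> x \<Longrightarrow> 0 \<le> CU x"
    and CU_mono: "mono_on {0..} CU"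
    and CU_concave: "concave_on {0..} CU"
    and CU_zero: "CU 0 = 0"
    and CU_strict: "strictly_concave_on {0..} CU"
    and epi_LCU: "epi_LCU = epigraph unit_cube (LCU_sum L PDT CU)"
  shows "epi_LCU = solutions L PDT CU (rank_labeled_trees T) {1..T} {1..T} \<and>
    (\<forall>B\<in>rank_labeled_trees T.
       solutions L PDT CU (rank_labeled_trees T - {B}) {1..T} {1..T} \<noteq> epi_LCU) \<and>
    (\<forall>t\<in>{1..T}.
       solutions L PDT CU (rank_labeled_trees T) ({1..T} - {t}) {1..T} \<noteq> epi_LCU) \<and>
    (\<forall>t\<in>{1..T}.
       solutions L PDT CU (rank_labeled_trees T) {1..T} ({1..T} - {t}) \<noteq> epi_LCU)"
proof -
  have monge: "strict_monge (gap_cost (CARD('n)) L PDT CU) (Suc (CARD('n)))"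
    using L_pos PDT_nonneg CU_mono CU_strict unfolding T by (rule gap_cost_strict_monge)
  let ?val = "\<lambda>v :: (real, 'n) vec.
    tree_val (gap_cost (CARD('n)) L PDT CU) (at_period v) 0 (Suc (CARD('n)))"
  have epi: "epi_LCU = solutions L PDT CU (rank_labeled_trees T) {1..T} {1..T}"
    unfolding epi_LCU T epigraph_LCU_sum[OF monge] by (rule convex_hull_eq_solutions[OF monge])
  have mem: "(v, a) \<in> solutions L PDT CU \<B> P Q \<longleftrightarrow> (\<forall>B\<in>\<B>. ?val v B \<le> a) \<and>
      (\<forall>t\<in>P. 0 \<le> at_period v t) \<and> (\<forall>t\<in>Q. at_period v t \<le> 1)"
    if "\<B> \<subseteq> rank_labeled_trees T" for v :: "(real, 'n) vec" and a \<B> P Q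
    using that unfolding T by (rule mem_solutions_iff)
  have "solutions L PDT CU (rank_labeled_trees T - {B}) {1..T} {1..T} \<noteq> epi_LCU"
    if B: "B \<in> rank_labeled_trees T" for B
  proof -
    obtain v :: "(real, 'n) vec" where v: "v \<in> unit_cube"
      and max: "\<And>B'. \<lbrakk>B' \<in> rank_labeled_trees T; B' \<noteq> B\<rbrakk> \<Longrightarrow> ?val v B' < ?val v B"
      using tree_strict_maximum[OF monge] B unfolding T by blast
    \<comment> \<open>The maximum is below the value of \<open>B\<close> but not below any other.
      The entry \<open>?val v B - 1\<close> keeps the set nonempty if \<open>B\<close> is the only
      tree.\<close>
    let ?A = "insert (?val v B - 1) (?val v ` (rank_labeled_trees T - {B}))"
    have fin: "finite ?A" using finite_rank_labeled_trees by simp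
    define a where "a = Max ?A"
    have "a \<in> ?A" unfolding a_def using fin by (intro Max_in) auto
    then have "a < ?val v B" using max by auto
    then have "(v, a) \<notin> epi_LCU" unfolding epi mem[OF subset_refl] using B by force
    moreover have "?val v B' \<le> a" if "B' \<in> rank_labeled_trees T - {B}" for B'
      unfolding a_def using that fin by (intro Max_ge) auto
    then have "(v, a) \<in> solutions L PDT CU (rank_labeled_trees T - {B}) {1..T} {1..T}"
      unfolding mem[OF Diff_subset] using v by (auto simp: unit_cube_def at_period_def)
    ultimately show ?thesis by blast
  qed
  moreover have "solutions L PDT CU (rank_labeled_trees T) ({1..T} - {t}) {1..T} \<noteq> epi_LCU"
    if t: "t \<in> {1..T}" for t
  proof -
    \<comment> \<open>The entry \<open>- 1\<close> breaks the omitted lower bound and respects the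
      upper one.\<close>
    obtain v :: "(real, 'n) vec" and a where v: "at_period v t = - 1"
      "\<And>s. s \<in> {1..T} \<Longrightarrow> s \<noteq> t \<Longrightarrow> at_period v s = 0"
      "\<And>B. B \<in> rank_labeled_trees T \<Longrightarrow> ?val v B \<le> a"
      using period_bound_violated[of t "- 1"] t unfolding T by blast
    have "at_period v s \<le> 1" if "s \<in> {1..T}" for s using v that by (cases "s = t") auto
    then have "(v, a) \<in> solutions L PDT CU (rank_labeled_trees T) ({1..T} - {t}) {1..T}"
      unfolding mem[OF subset_refl] using v by auto
    moreover have "\<not> 0 \<le> at_period v t" using v(1) by simp
    then have "(v, a) \<notin> epi_LCU" unfolding epi mem[OF subset_refl] using t by blast
    ultimately show ?thesis by blast
  qed
  moreover have "solutions L PDT CU (rank_labeled_trees T) {1..T} ({1..T} - {t}) \<noteq> epi_LCU"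
    if t: "t \<in> {1..T}" for t
  proof -
    \<comment> \<open>Likewise \<open>2\<close> breaks the omitted upper bound alone.\<close>
    obtain v :: "(real, 'n) vec" and a where v: "at_period v t = 2"
      "\<And>s. s \<in> {1..T} \<Longrightarrow> s \<noteq> t \<Longrightarrow> at_period v s = 0"
      "\<And>B. B \<in> rank_labeled_trees T \<Longrightarrow> ?val v B \<le> a"
      using period_bound_violated[of t 2] t unfolding T by blast
    have "0 \<le> at_period v s" if "s \<in> {1..T}" for s using v that by (cases "s = t") auto
    then have "(v, a) \<in> solutions L PDT CU (rank_labeled_trees T) {1..T} ({1..T} - {t})"
      unfolding mem[OF subset_refl] using v by auto
    moreover have "\<not> at_period v t \<le> 1" using v(1) by simp
    then have "(v, a) \<notin> epi_LCU" unfolding epi mem[OF subset_refl] using t by blast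
    ultimately show ?thesis by blast
  qed
  ultimately show ?thesis using epi by blast
qed

end
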